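(* Let $G=(V,E)$ be a finite directed acyclic planar graph, $N\ge1$, and let $\mathcal X\subset V$ (source vertices) and $\mathcal Y\subset V$ (sink vertices) be sets with at least $N$ elements each. Let $w_e\in\mathbb R$ and $\tilde w_e\in\mathbb R$, $e\in E$, be two sets of edge weights, and let $\psi_i:\mathcal X\to\mathbb R$ and $\varphi_i:\mathcal Y\to\mathbb R$, $1\le i\le N$, be functions. For $x\in\mathcal X$, $y\in\mathcal Y$ let $\mathcal W(x,y)=\sum_{\pi:x\to y}w(\pi)$ and $\widetilde{\mathcal W}(x,y)=\sum_{\pi:x\to y}\tilde w(\pi)$, and let $\varphi_j^{(b)}(x)=\sum_{y\in\mathcal Y}\mathcal W(x,y)\varphi_j(y)$ for $x\in\mathcal X$. Assume the biorthogonality condition $$\sum_{x\in\mathcal X}\psi_i(x)\varphi_j^{(b)}(x)=\mathbf 1_{i=j},\qquad 1\le i,j\le N.$$ Let $Z$ and $\widetilde Z$ be the partition functions of $N$ non-intersecting paths from $\mathcal X$ to $\mathcal Y$ (defined in the context) with boundary functions $\{\psi_i\},\{\varphi_j\}$ and edge weights $\{w_e\}$ and $\{\tilde w_e\}$ respectively. Then $$\frac{\widetilde Z}{Z}=\det\big(I-K+\widetilde{\mathcal W}\mathcal W^{-1}K\big)_{L^2(\mathcal X)},$$ where $K:L^2(\mathcal X)\to L^2(\mathcal X)$ has kernel $K(x_1,x_2)=\sum_{i=1}^N\varphi_i^{(b)}(x_1)\psi_i(x_2)$, $\mathcal W^{-1}K:L^2(\mathcal X)\to L^2(\mathcal Y)$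 is the operator $\mathcal W^{-1}Kf=\sum_{i=1}^N\langle\psi_i,f\rangle_{L^2(\mathcal X)}\,\varphi_i$, and $\widetilde{\mathcal W}:L^2(\mathcal Y)\to L^2(\mathcal X)$ is $\widetilde{\mathcal W}g(x)=\sum_{y\in\mathcal Y}\widetilde{\mathcal W}(x,y)g(y)$.
   Context: A directed path $\pi$ is a sequence of vertices connecting a vertex $\pi(b)\in\mathcal X$ to a vertex $\pi(d)\in\mathcal Y$ via directed edges of $E$; its weight $w(\pi)$ is the product of $w_e$ over the edges $e$ of $\pi$ (similarly $\tilde w(\pi)$), and $\sum_{\pi:x\to y}$ is over all directed paths from $x$ to $y$. Two paths intersect if their vertex sets have non-empty intersection. $\mathcal{N.I.}(N;\mathcal X\to\mathcal Y)$ is the set of (unordered) collections $\Pi=\{\pi_1,\dots,\pi_N\}$ of $N$ directed paths with $\pi_i(b)\in\mathcal X$, $\pi_i(d)\in\mathcal Y$, no two of which intersect. For edge weights $\{w_e\}$, $$Wt(\Pi)=\det[\psi_i(\pi_j(b))]_{i,j=1}^N\Big(\prod_{i=1}^Nw(\pi_i)\Big)\det[\varphi_i(\pi_j(d))]_{i,j=1}^N$$ (independent of the labelling of the paths) and $Z=\sum_{\Pi\in\mathcal{N.I.}(N;\mathcal X\to\mathcal Y)}Wt(\Pi)$; $\widetilde Z$ is defined in the same way with $w$ replaced by $\tilde w$ (and the same $\psi_i,\varphi_j$). $L^2$ of a finite set is with respect to counting measure, so the determinant is an ordinary one. (The operator $\mathcal W^{-1}K$ is the composition of $K$ with the right inverse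 of $\mathcal W$ on $\mathrm{span}\{\varphi_i^{(b)}\}$ given by $\varphi_j^{(b)}\mapsto\varphi_j$.) *)

theory Defs
  imports
    "HOL-Analysis.Path_Connected"
    "HOL-Combinatorics.Permutations"
    "Graph_Theory.Pair_Digraph"
    "Graph_Theory.Vertex_Walk"
    "Jordan_Normal_Form.Determinant"
begin

section \<open>Planar digraphs\<close>

text \<open>
  A drawing without crossings: distinct vertices go to distinct points of the plane, and every
  edge goes to a simple curve between the images of its endpoints. The curve meets no other
  vertex, and two different curves meet only at images of vertices (hence at images of common
  endpoints).
\<close>

definition planar_drawing ::
    "('a, 'b) pre_digraph \<Rightarrow> ('a \<Rightarrow> complex) \<Rightarrow> ('b \<Rightarrow> real \<Rightarrow> complex) \<Rightarrow> bool" where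
  "planar_drawing G pos \<gamma> \<longleftrightarrow>
     inj_on pos (verts G) \<and>
     (\<forall>e\<in>arcs G. arc (\<gamma> e) \<and>
        pathstart (\<gamma> e) = pos (tail G e) \<and> pathfinish (\<gamma> e) = pos (head G e) \<and>
        path_image (\<gamma> e) \<inter> pos ` verts G = {pos (tail G e), pos (head G e)}) \<and>
     (\<forall>e\<in>arcs G. \<forall>e'\<in>arcs G. e \<noteq> e' \<longrightarrow>
        path_image (\<gamma> e) \<inter> path_image (\<gamma> e') \<subseteq> pos ` verts G)"

text \<open>
  The edge curves are injective up to and including their endpoints, so this notion is only
  suitable for digraphs without loops, such as acyclic ones.
\<close>

definition planar_digraph :: "('a, 'b) pre_digraph \<Rightarrow> bool" where
  "planar_digraph G \<longleftrightarrow> (\<exists>pos \<gamma>. planar_drawing G pos \<gamma>)"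


section \<open>Directed paths and their weights\<close>

text \<open>
  A one-vertex list is a path without edges, of weight \<open>1\<close>. No distinctness is demanded, since
  in an acyclic digraph a walk cannot repeat a vertex.
\<close>

definition dipaths :: "'a pair_pre_digraph \<Rightarrow> 'a \<Rightarrow> 'a \<Rightarrow> 'a list set" where
  "dipaths G x y = {p. vwalk p (with_proj G) \<and> hd p = x \<and> last p = y}"

definition path_weight :: "('a \<times> 'a \<Rightarrow> real) \<Rightarrow> 'a list \<Rightarrow> real" where
  "path_weight w p = (\<Prod>e\<leftarrow>vwalk_arcs p. w e)"

definition path_kernel :: "'a pair_pre_digraph \<Rightarrow> ('a \<times> 'a \<Rightarrow> real) \<Rightarrow> 'a \<Rightarrow> 'a \<Rightarrow> real" where
  "path_kernel G w x y = (\<Sum>p\<in>dipaths G x y. path_weight w p)"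


section \<open>Non-intersecting paths\<close>

definition nonintersecting ::
    "'a pair_pre_digraph \<Rightarrow> nat \<Rightarrow> 'a set \<Rightarrow> 'a set \<Rightarrow> 'a list set set" where
  "nonintersecting G N X Y =
     {F. F \<subseteq> (\<Union>x\<in>X. \<Union>y\<in>Y. dipaths G x y) \<and> finite F \<and> card F = N \<and>
         pairwise (\<lambda>p q. disjnt (set p) (set q)) F}"

definition labelled_weight ::
    "nat \<Rightarrow> (nat \<Rightarrow> 'a \<Rightarrow> real) \<Rightarrow> (nat \<Rightarrow> 'a \<Rightarrow> real) \<Rightarrow> ('a \<times> 'a \<Rightarrow> real) \<Rightarrow> 'a list list \<Rightarrow> real" where
  "labelled_weight N \<psi> \<phi> w ps =
     det (mat N N (\<lambda>(i, j). \<psi> i (hd (ps ! j)))) *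
     (\<Prod>i<N. path_weight w (ps ! i)) *
     det (mat N N (\<lambda>(i, j). \<phi> i (last (ps ! j))))"

text \<open>
  The chosen labelling is immaterial, see \<open>family_weight_eq\<close> below.
\<close>

definition family_weight ::
    "nat \<Rightarrow> (nat \<Rightarrow> 'a \<Rightarrow> real) \<Rightarrow> (nat \<Rightarrow> 'a \<Rightarrow> real) \<Rightarrow> ('a \<times> 'a \<Rightarrow> real) \<Rightarrow> 'a list set \<Rightarrow> real" where
  "family_weight N \<psi> \<phi> w F = labelled_weight N \<psi> \<phi> w (SOME ps. distinct ps \<and> set ps = F)"

definition partition_function ::
    "'a pair_pre_digraph \<Rightarrow> nat \<Rightarrow> 'a set \<Rightarrow> 'a set \<Rightarrow> (nat \<Rightarrow> 'a \<Rightarrow> real) \<Rightarrow> (nat \<Rightarrow> 'a \<Rightarrow> real) \<Rightarrow>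
      ('a \<times> 'a \<Rightarrow> real) \<Rightarrow> real" where
  "partition_function G N X Y \<psi> \<phi> w =
     (\<Sum>F\<in>nonintersecting G N X Y. family_weight N \<psi> \<phi> w F)"

lemma det_mat_permute_columns:
  fixes f :: "nat \<Rightarrow> nat \<Rightarrow> real"
  assumes s: "s permutes {..<N}"
  shows "det (mat N N (\<lambda>(i, j). f i (s j))) = signof s * det (mat N N (\<lambda>(i, j). f i j))"
proof -
  let ?A = "mat N N (\<lambda>(i, j). f i j)"
  have s': "s permutes {0..<N}" using s by (simp add: lessThan_atLeast0)
  have lt: "s j < N" if "j < N" for j
    using permutes_in_image[OF s, of j] that by simp
  have "mat N N (\<lambda>(i, j). f i (s j))
      = transpose_mat (mat N N (\<lambda>(i, j). transpose_mat ?A $$ (s i, j)))"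
    by (rule eq_matI) (auto simp: lt)
  then have "det (mat N N (\<lambda>(i, j). f i (s j)))
      = det (mat N N (\<lambda>(i, j). transpose_mat ?A $$ (s i, j)))"
    using det_transpose[of "mat N N (\<lambda>(i, j). transpose_mat ?A $$ (s i, j))" N] by simp
  also have "\<dots> = signof s * det (transpose_mat ?A)"
    by (rule det_permute_rows[OF _ s']) simp
  also have "det (transpose_mat ?A) = det ?A"
    by (rule det_transpose[of _ N]) simp
  finally show ?thesis .
qed

lemma labelled_weight_relabel:
  assumes "distinct ps" "distinct qs" "set ps = set qs" "length qs = N"
  shows "labelled_weight N \<psi> \<phi> w ps = labelled_weight N \<psi> \<phi> w qs"
proof -
  have "mset ps = mset qs"
    using assms set_eq_iff_mset_eq_distinct by blast
  then obtain s where s: "s permutes {..<N}" and ps: "permute_list s qs = ps"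
    using mset_eq_permutation assms(4) by metis
  have nth: "ps ! j = qs ! s j" if "j < N" for j
    using that s assms(4) ps permute_list_nth[of s qs j] by auto
  have eq: "mat N N (\<lambda>(i, j). \<psi> i (hd (ps ! j))) = mat N N (\<lambda>(i, j). \<psi> i (hd (qs ! s j)))"
    "mat N N (\<lambda>(i, j). \<phi> i (last (ps ! j))) = mat N N (\<lambda>(i, j). \<phi> i (last (qs ! s j)))"
    by (auto intro!: cong_mat simp: nth)
  have "(\<Prod>i<N. path_weight w (ps ! i)) = (\<Prod>i<N. path_weight w (qs ! s i))"
    by (simp add: nth)
  also have "\<dots> = (\<Prod>i<N. path_weight w (qs ! i))"
    using prod.permute[OF s, of "\<lambda>i. path_weight w (qs ! i)"] by (simp add: comp_def)
  finally have prod: "(\<Prod>i<N. path_weight w (ps ! i)) = (\<Prod>i<N. path_weight w (qs ! i))" .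
  show ?thesis
    unfolding labelled_weight_def eq prod
      det_mat_permute_columns[OF s, of "\<lambda>i j. \<psi> i (hd (qs ! j))"]
      det_mat_permute_columns[OF s, of "\<lambda>i j. \<phi> i (last (qs ! j))"]
    by (cases "evenperm s") (simp_all add: sign_def)
qed

lemma family_weight_eq:
  assumes "distinct ps" "set ps = F" "card F = N"
  shows "family_weight N \<psi> \<phi> w F = labelled_weight N \<psi> \<phi> w ps"
proof -
  have "distinct (SOME ps. distinct ps \<and> set ps = F) \<and> set (SOME ps. distinct ps \<and> set ps = F) = F"
    by (rule someI[of _ ps]) (use assms in simp)
  then show ?thesis
    unfolding family_weight_def
    using assms by (intro labelled_weight_relabel) (auto simp: distinct_card)
qed


section \<open>Operators on functions on a finite set\<close>

text \<open>
  Elements of \<open>L\<^sup>2(S)\<close>, for a finite set \<open>S\<close> of vertices, are represented by functions on the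
  whole vertex type, of which only the values on \<open>S\<close> matter.
\<close>

definition inner_on :: "'a set \<Rightarrow> ('a \<Rightarrow> real) \<Rightarrow> ('a \<Rightarrow> real) \<Rightarrow> real" where
  "inner_on S f g = (\<Sum>x\<in>S. f x * g x)"

definition kernel_operator :: "'a set \<Rightarrow> ('a \<Rightarrow> 'a \<Rightarrow> real) \<Rightarrow> ('a \<Rightarrow> real) \<Rightarrow> ('a \<Rightarrow> real)" where
  "kernel_operator S k f = (\<lambda>x. \<Sum>y\<in>S. k x y * f y)"

text \<open>
  The Leibniz formula, for a matrix whose rows and columns are indexed by \<open>S\<close>. It is the
  determinant with respect to any enumeration of \<open>S\<close>, see \<open>det_on_eq_det\<close>.
\<close>

definition det_on :: "'a set \<Rightarrow> ('a \<Rightarrow> 'a \<Rightarrow> real) \<Rightarrow> real" where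
  "det_on S A = (\<Sum>p | p permutes S. of_int (sign p) * (\<Prod>x\<in>S. A x (p x)))"

text \<open>
  The \<open>(x, y)\<close> entry of the matrix of an operator \<open>T\<close> is the value at \<open>x\<close> of \<open>T\<close> applied to the
  basis function of \<open>y\<close>.
\<close>

definition operator_det :: "'a set \<Rightarrow> (('a \<Rightarrow> real) \<Rightarrow> ('a \<Rightarrow> real)) \<Rightarrow> real" where
  "operator_det S T = det_on S (\<lambda>x y. T (indicator {y}) x)"

lemma det_on_eq_det:
  assumes "distinct xs"
  shows "det_on (set xs) A = det (mat (length xs) (length xs) (\<lambda>(i, j). A (xs ! i) (xs ! j)))"
proof -
  let ?n = "length xs"
  let ?I = "{0..<?n}"
  let ?m = "map_permutation ?I (\<lambda>i. xs ! i)"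
  let ?m' = "map_permutation (set xs) (inv_into ?I (\<lambda>i. xs ! i))"
  have bij: "bij_betw (\<lambda>i. xs ! i) ?I (set xs)"
    using bij_betw_nth[OF assms] by (simp add: lessThan_atLeast0)
  have bij': "bij_betw (inv_into ?I (\<lambda>i. xs ! i)) (set xs) ?I"
    using bij by (rule bij_betw_inv_into)
  have inj: "inj_on (\<lambda>i. xs ! i) ?I"
    using bij by (simp add: bij_betw_def)
  have "det (mat ?n ?n (\<lambda>(i, j). A (xs ! i) (xs ! j)))
      = (\<Sum>p | p permutes ?I. of_int (sign p) * (\<Prod>i\<in>?I. A (xs ! i) (xs ! p i)))"
    by (subst det_def'[of _ ?n]) (auto intro!: sum.cong prod.cong)
  also have "\<dots> = (\<Sum>q | q permutes set xs. of_int (sign q) * (\<Prod>x\<in>set xs. A x (q x)))"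
  proof (rule sum.reindex_bij_witness[of _ ?m' ?m])
    fix p assume "p \<in> {p. p permutes ?I}"
    then have p: "p permutes ?I" by simp
    show "?m' (?m p) = p"
      by (rule map_permutation_compose_inv[OF bij p]) (rule inv_into_f_f[OF inj])
    show "?m p \<in> {q. q permutes set xs}"
      using map_permutation_permutes[OF bij p] by simp
    have sgn: "sign (?m p) = sign p"
      using p inj by (intro sign_map_permutation) auto
    have "(\<Prod>x\<in>set xs. A x (?m p x)) = (\<Prod>i\<in>?I. A (xs ! i) (?m p (xs ! i)))"
      by (rule prod.reindex_bij_betw[OF bij, symmetric])
    also have "\<dots> = (\<Prod>i\<in>?I. A (xs ! i) (xs ! p i))"
      by (rule prod.cong) (auto simp: map_permutation_apply[OF inj])
    finally show "of_int (sign (?m p)) * (\<Prod>x\<in>set xs. A x (?m p x))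
        = of_int (sign p) * (\<Prod>i\<in>?I. A (xs ! i) (xs ! p i))"
      using sgn by simp
  next
    fix q assume "q \<in> {q. q permutes set xs}"
    then have q: "q permutes set xs" by simp
    show "?m (?m' q) = q"
      by (rule map_permutation_compose_inv[OF bij' q])
        (use bij in \<open>simp add: bij_betw_inv_into_right\<close>)
    show "?m' q \<in> {p. p permutes ?I}"
      using map_permutation_permutes[OF bij' q] by simp
  qed
  finally show ?thesis unfolding det_on_def by simp
qed


section \<open>The operators of the path model\<close>

text \<open>
  The kernel \<open>K(x1, x2)\<close> of the projection \<open>K\<close>, where \<open>\<phi> i\<close> propagated back from \<open>Y\<close> to \<open>X\<close> by
  the path kernel \<open>W\<close> plays the role of \<open>\<phi>\<^sub>i\<^sup>(\<^sup>b\<^sup>)\<close>; and the operator \<open>W\<^sup>-\<^sup>1K\<close>, given directly by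
  \<open>f \<mapsto> \<Sum>i<N. \<langle>\<psi> i, f\<rangle> \<phi> i\<close>, so that no inverse of \<open>W\<close> occurs.
\<close>

definition boundary_kernel ::
    "'a pair_pre_digraph \<Rightarrow> nat \<Rightarrow> 'a set \<Rightarrow> (nat \<Rightarrow> 'a \<Rightarrow> real) \<Rightarrow> (nat \<Rightarrow> 'a \<Rightarrow> real) \<Rightarrow>
      ('a \<times> 'a \<Rightarrow> real) \<Rightarrow> 'a \<Rightarrow> 'a \<Rightarrow> real" where
  "boundary_kernel G N Y \<psi> \<phi> w x1 x2 =
     (\<Sum>i<N. kernel_operator Y (path_kernel G w) (\<phi> i) x1 * \<psi> i x2)"

definition inverse_kernel_operator ::
    "nat \<Rightarrow> 'a set \<Rightarrow> (nat \<Rightarrow> 'a \<Rightarrow> real) \<Rightarrow> (nat \<Rightarrow> 'a \<Rightarrow> real) \<Rightarrow> ('a \<Rightarrow> real) \<Rightarrow> ('a \<Rightarrow> real)" where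
  "inverse_kernel_operator N X \<psi> \<phi> f = (\<lambda>y. \<Sum>i<N. inner_on X (\<psi> i) f * \<phi> i y)"

end

theory Submission
  imports Defs "HOL-Combinatorics.Multiset_Permutations"
begin

text \<open>
  Expand the two boundary determinants of every weight by the Leibniz formula and sum over all
  ordered \<open>N\<close>-tuples of paths, intersecting or not: the sum factorises into \<open>N!\<close> times the
  determinant of the matrix \<open>\<langle>\<psi> i, W (\<phi> j)\<rangle>\<close>. Switching the tails of two paths at a common vertex
  exchanges two columns of the determinant in \<open>\<phi>\<close> and leaves the other factors unchanged, so the
  intersecting tuples cancel, and each non-intersecting family is counted \<open>N!\<close> times. Hence the
  partition function is \<open>det \<langle>\<psi> i, W (\<phi> j)\<rangle>\<close>, which is \<open>1\<close> for \<open>w\<close> by biorthogonality. On the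
  other side the operator is a rank \<open>N\<close> perturbation of the identity, and \<open>det (1 + U V) = det (1 + V U)\<close>
  reduces its determinant to \<open>det \<langle>\<psi> i, W' (\<phi> j)\<rangle>\<close>.
\<close>

section \<open>Determinants\<close>

text \<open>Both sides equal the determinant of the block matrix \<open>?M\<close>: multiplying it
  from the left by the unitriangular \<open>?L\<close> clears its lower left block, by
  \<open>?R\<close> its upper right one. This way no inverse of \<open>U\<close> or \<open>V\<close>
  occurs.\<close>

lemma det_one_plus_mult_commute:
  fixes U V :: "'a :: idom mat"
  assumes U: "U \<in> carrier_mat n m" and V: "V \<in> carrier_mat m n"
  shows "det (1\<^sub>m n + U * V) = det (1\<^sub>m m + V * U)"
proof -
  let ?M = "four_block_mat (1\<^sub>m m) (- V) U (1\<^sub>m n)"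
  let ?L = "four_block_mat (1\<^sub>m m) (0\<^sub>m m n) (- U) (1\<^sub>m n)"
  let ?R = "four_block_mat (1\<^sub>m m) V (0\<^sub>m n m) (1\<^sub>m n)"
  have M: "?M \<in> carrier_mat (m + n) (m + n)" and L: "?L \<in> carrier_mat (m + n) (m + n)"
    and R: "?R \<in> carrier_mat (m + n) (m + n)"
    using U V by auto
  have LM: "?L * ?M = four_block_mat (1\<^sub>m m) (- V) (0\<^sub>m n m) (1\<^sub>m n + U * V)"
  proof -
    have "?L * ?M = four_block_mat (1\<^sub>m m * 1\<^sub>m m + 0\<^sub>m m n * U) (1\<^sub>m m * - V + 0\<^sub>m m n * 1\<^sub>m n)
        (- U * 1\<^sub>m m + 1\<^sub>m n * U) (- U * - V + 1\<^sub>m n * 1\<^sub>m n)"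
      by (rule mult_four_block_mat) (use U V in auto)
    also have "1\<^sub>m m * 1\<^sub>m m + 0\<^sub>m m n * U = 1\<^sub>m m" using U by auto
    also have "1\<^sub>m m * - V + 0\<^sub>m m n * 1\<^sub>m n = - V" using V by auto
    also have "- U * 1\<^sub>m m + 1\<^sub>m n * U = 0\<^sub>m n m"
      using U uminus_l_inv_mat[OF U] by auto
    also have "- U * - V + 1\<^sub>m n * 1\<^sub>m n = 1\<^sub>m n + U * V"
      using U V comm_add_mat[of "U * V" n n "1\<^sub>m n"] by auto
    finally show ?thesis .
  qed
  have RM: "?R * ?M = four_block_mat (1\<^sub>m m + V * U) (0\<^sub>m m n) U (1\<^sub>m n)"
  proof -
    have "?R * ?M = four_block_mat (1\<^sub>m m * 1\<^sub>m m + V * U) (1\<^sub>m m * - V + V * 1\<^sub>m n)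
        (0\<^sub>m n m * 1\<^sub>m m + 1\<^sub>m n * U) (0\<^sub>m n m * - V + 1\<^sub>m n * 1\<^sub>m n)"
      by (rule mult_four_block_mat) (use U V in auto)
    also have "1\<^sub>m m * - V + V * 1\<^sub>m n = 0\<^sub>m m n"
      using V uminus_l_inv_mat[OF V] by auto
    also have "0\<^sub>m n m * 1\<^sub>m m + 1\<^sub>m n * U = U" using U by auto
    also have "0\<^sub>m n m * - V + 1\<^sub>m n * 1\<^sub>m n = 1\<^sub>m n" using V by auto
    finally show ?thesis by simp
  qed
  have "det ?L = 1"
    using det_four_block_mat_upper_right_zero[of "1\<^sub>m m" m "0\<^sub>m m n" n "- U" "1\<^sub>m n"] U by simp
  then have "det (?L * ?M) = det ?M"
    using det_mult[OF L M] by simp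
  moreover have "det (?L * ?M) = det (1\<^sub>m n + U * V)"
    unfolding LM
    using det_four_block_mat_lower_left_zero[of "1\<^sub>m m" m "- V" n "0\<^sub>m n m" "1\<^sub>m n + U * V"] U V
    by simp
  moreover have "det ?R = 1"
    using det_four_block_mat_lower_left_zero[of "1\<^sub>m m" m V n "0\<^sub>m n m" "1\<^sub>m n"] V by simp
  then have "det (?R * ?M) = det ?M"
    using det_mult[OF R M] by simp
  moreover have "det (?R * ?M) = det (1\<^sub>m m + V * U)"
    unfolding RM
    using det_four_block_mat_upper_right_zero[of "1\<^sub>m m + V * U" m "0\<^sub>m m n" n U "1\<^sub>m n"] U V
    by simp
  ultimately show ?thesis by simp
qed

text \<open>Column \<open>j\<close> will belong to the \<open>j\<close>-th path, so the permutation
  is put on the index of the boundary function and the product runs over paths.\<close>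

lemma det_mat_expand_columns:
  fixes f :: "nat \<Rightarrow> nat \<Rightarrow> real"
  shows "det (mat N N (\<lambda>(i, j). f i j)) =
    (\<Sum>s | s permutes {..<N}. signof s * (\<Prod>j<N. f (s j) j))"
proof -
  have "s j < N" if "s permutes {..<N}" "j < N" for s j
    using permutes_in_image[OF that(1), of j] that(2) by simp
  then show ?thesis
    by (subst det_col[of _ N]) (auto simp: lessThan_atLeast0 intro!: sum.cong prod.cong)
qed

text \<open>For fixed \<open>t\<close> the sum over \<open>s\<close> is the sign of \<open>t\<close>
  times a determinant with columns permuted by \<open>t\<close>. The two signs cancel, so each of
  the \<open>N!\<close> choices of \<open>t\<close> gives the same value. The double sum is the
  shape produced by expanding both boundary determinants.\<close>

lemma fact_mult_det:
  fixes M :: "nat \<Rightarrow> nat \<Rightarrow> real"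
  shows "fact N * det (mat N N (\<lambda>(i, j). M i j)) =
    (\<Sum>s | s permutes {..<N}. \<Sum>t | t permutes {..<N}.
      signof s * signof t * (\<Prod>j<N. M (s j) (t j)))"
proof -
  have "(\<Sum>s | s permutes {..<N}. signof s * signof t * (\<Prod>j<N. M (s j) (t j))) =
      det (mat N N (\<lambda>(i, j). M i j))" if t: "t permutes {..<N}" for t
  proof -
    have "(\<Sum>s | s permutes {..<N}. signof s * signof t * (\<Prod>j<N. M (s j) (t j))) =
        signof t * det (mat N N (\<lambda>(i, j). M i (t j)))"
      unfolding det_mat_expand_columns[of N "\<lambda>i j. M i (t j)"]
      by (simp add: sum_distrib_left mult_ac)
    also have "\<dots> = det (mat N N (\<lambda>(i, j). M i j))"
      using det_mat_permute_columns[OF t, of M] by (simp add: sign_def)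
    finally show ?thesis .
  qed
  then have "(\<Sum>t | t permutes {..<N}. \<Sum>s | s permutes {..<N}.
      signof s * signof t * (\<Prod>j<N. M (s j) (t j))) =
      real (card {t. t permutes {..<N}}) * det (mat N N (\<lambda>(i, j). M i j))"
    by simp
  moreover have "card {t. t permutes {..<N}} = fact N"
    by (rule card_permutations) auto
  ultimately show ?thesis
    by (subst sum.swap) simp
qed

section \<open>Sums over ordered tuples of paths\<close>

lemma prod_sum_lists:
  fixes f :: "nat \<Rightarrow> 'b \<Rightarrow> real"
  assumes "finite P"
  shows "(\<Prod>j<N. \<Sum>p\<in>P. f j p) = (\<Sum>ps | set ps \<subseteq> P \<and> length ps = N. \<Prod>j<N. f j (ps ! j))"
proof -
  have "(\<Prod>j<N. \<Sum>p\<in>P. f j p) = (\<Sum>g\<in>PiE {..<N} (\<lambda>_. P). \<Prod>j<N. f j (g j))"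
    using assms by (intro prod_sum_PiE) auto
  also have "\<dots> = (\<Sum>ps | set ps \<subseteq> P \<and> length ps = N. \<Prod>j<N. f j (ps ! j))"
    by (rule sum.reindex_bij_witness[of _ "\<lambda>ps. restrict ((!) ps) {..<N}" "\<lambda>g. map g [0..<N]"])
      (auto simp: fun_eq_iff PiE_def extensional_def intro!: nth_equalityI)
  finally show ?thesis .
qed

text \<open>After both Leibniz expansions, for fixed \<open>s\<close> and \<open>t\<close> the
  \<open>j\<close>-th factor involves only the \<open>j\<close>-th path. Since the tuples are
  unrestricted, their sum is a product over \<open>j\<close> of entries
  \<open>?M (s j) (t j)\<close>.\<close>

lemma sum_labelled_weight:
  assumes "finite P"
  shows "(\<Sum>ps | set ps \<subseteq> P \<and> length ps = N. labelled_weight N \<psi> \<phi> w ps) =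
    fact N * det (mat N N (\<lambda>(i, j). \<Sum>p\<in>P. \<psi> i (hd p) * path_weight w p * \<phi> j (last p)))"
    (is "?l = fact N * det (mat N N (\<lambda>(i, j). ?M i j))")
proof -
  let ?S = "{s. s permutes {..<N}}" and ?L = "{ps. set ps \<subseteq> P \<and> length ps = N}"
  have "labelled_weight N \<psi> \<phi> w ps = (\<Sum>s\<in>?S. \<Sum>t\<in>?S. signof s * signof t *
      (\<Prod>j<N. \<psi> (s j) (hd (ps ! j)) * path_weight w (ps ! j) * \<phi> (t j) (last (ps ! j))))" for ps
    unfolding labelled_weight_def
      det_mat_expand_columns[of N "\<lambda>i j. \<psi> i (hd (ps ! j))"]
      det_mat_expand_columns[of N "\<lambda>i j. \<phi> i (last (ps ! j))"]
    by (simp add: sum_distrib_left sum_distrib_right prod.distrib mult_ac)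
  then have "?l = (\<Sum>ps\<in>?L. \<Sum>s\<in>?S. \<Sum>t\<in>?S. signof s * signof t *
      (\<Prod>j<N. \<psi> (s j) (hd (ps ! j)) * path_weight w (ps ! j) * \<phi> (t j) (last (ps ! j))))"
    by simp
  also have "\<dots> = (\<Sum>s\<in>?S. \<Sum>t\<in>?S. signof s * signof t * (\<Sum>ps\<in>?L.
      \<Prod>j<N. \<psi> (s j) (hd (ps ! j)) * path_weight w (ps ! j) * \<phi> (t j) (last (ps ! j))))"
    unfolding sum_distrib_left by (subst sum.swap) (intro sum.cong refl, subst sum.swap, simp)
  also have "\<dots> = (\<Sum>s\<in>?S. \<Sum>t\<in>?S. signof s * signof t * (\<Prod>j<N. ?M (s j) (t j)))"
    using prod_sum_lists[OF assms,
      of "\<lambda>j p. \<psi> (s j) (hd p) * path_weight w p * \<phi> (t j) (last p)" N for s t]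
    by simp
  finally show ?thesis
    unfolding fact_mult_det[of N ?M] .
qed

section \<open>Switching tails\<close>

text \<open>Cutting both lists at the first occurrence of \<open>v\<close> makes two splices undo
  each other, even for lists with repeated vertices.\<close>

definition splice_at :: "'a \<Rightarrow> 'a list \<Rightarrow> 'a list \<Rightarrow> 'a list" where
  "splice_at v p q = takeWhile (\<lambda>u. u \<noteq> v) p @ dropWhile (\<lambda>u. u \<noteq> v) q"

lemma splice_at_append_Cons:
  assumes "v \<notin> set a" "v \<notin> set c"
  shows "splice_at v (a @ v # b) (c @ v # d) = a @ v # d"
  using assms by (simp add: splice_at_def takeWhile_append dropWhile_append)

lemma splice_at_cases:
  assumes "v \<in> set p" "v \<in> set q"
  obtains a b c d where "p = a @ v # b" "q = c @ v # d" "v \<notin> set a" "v \<notin> set c"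
    "splice_at v p q = a @ v # d" "splice_at v q p = c @ v # b"
proof -
  obtain a b where p: "p = a @ v # b" "v \<notin> set a" using split_list_first[OF assms(1)] by auto
  obtain c d where q: "q = c @ v # d" "v \<notin> set c" using split_list_first[OF assms(2)] by auto
  show ?thesis
    by (rule that[OF p(1) q(1) p(2) q(2)]) (simp_all add: p q splice_at_append_Cons)
qed

lemma
  assumes "v \<in> set p" "v \<in> set q"
  shows mem_splice_at: "v \<in> set (splice_at v p q)"
    and hd_splice_at: "hd (splice_at v p q) = hd p"
    and last_splice_at: "last (splice_at v p q) = last q"
    and splice_at_splice_at: "splice_at v (splice_at v p q) (splice_at v q p) = p"
    and mset_splice_at: "mset (splice_at v p q) + mset (splice_at v q p) = mset p + mset q"
  by (rule splice_at_cases[OF assms]; simp add: splice_at_append_Cons hd_append)+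

text \<open>Both pieces keep the cut vertex \<open>v\<close>, so no arc is lost. Weights and walk
  conditions of a splice can thus be read off the pieces.\<close>

lemma vwalk_arcs_append_Cons:
  "vwalk_arcs (a @ v # b) = vwalk_arcs (a @ [v]) @ vwalk_arcs (v # b)"
proof (induction a)
  case (Cons x a)
  then show ?case by (cases a) auto
qed simp

lemma path_weight_splice_at:
  assumes "v \<in> set p" "v \<in> set q"
  shows "path_weight w (splice_at v p q) * path_weight w (splice_at v q p) =
    path_weight w p * path_weight w q"
proof -
  have split: "path_weight w (a @ v # b) = path_weight w (a @ [v]) * path_weight w (v # b)" for a b
    unfolding path_weight_def vwalk_arcs_append_Cons[of a v b] by simp
  obtain a b c d where "p = a @ v # b" "q = c @ v # d"
    "splice_at v p q = a @ v # d" "splice_at v q p = c @ v # b"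
    using splice_at_cases[OF assms] by metis
  then show ?thesis
    using split[of a b] split[of c d] split[of a d] split[of c b] by simp
qed

lemma vwalk_splice_at:
  assumes "vwalk p G" "vwalk q G" "v \<in> set p" "v \<in> set q"
  shows "vwalk (splice_at v p q) G"
proof -
  obtain a b c d where "p = a @ v # b" "q = c @ v # d" "splice_at v p q = a @ v # d"
    using splice_at_cases[OF assms(3,4)] by metis
  then show ?thesis
    using assms(1,2) vwalk_arcs_append_Cons[of a v b] vwalk_arcs_append_Cons[of c v d]
      vwalk_arcs_append_Cons[of a v d]
    by (auto simp: vwalk_def)
qed

definition switch_tails :: "'a \<Rightarrow> nat \<Rightarrow> nat \<Rightarrow> 'a list list \<Rightarrow> 'a list list" where
  "switch_tails v i j ps = ps[i := splice_at v (ps ! i) (ps ! j), j := splice_at v (ps ! j) (ps ! i)]"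

lemma length_switch_tails [simp]: "length (switch_tails v i j ps) = length ps"
  by (simp add: switch_tails_def)

context
  fixes v :: 'a and i j :: nat and ps :: "'a list list"
  assumes ij: "i < length ps" "j < length ps" "i \<noteq> j"
    and v: "v \<in> set (ps ! i)" "v \<in> set (ps ! j)"
begin

lemma nth_switch_tails:
  "k < length ps \<Longrightarrow> switch_tails v i j ps ! k =
    (if k = i then splice_at v (ps ! i) (ps ! j)
     else if k = j then splice_at v (ps ! j) (ps ! i) else ps ! k)"
  using ij by (auto simp: switch_tails_def nth_list_update)

lemma switch_tails_switch_tails: "switch_tails v i j (switch_tails v i j ps) = ps"
proof (rule nth_equalityI)
  fix k assume "k < length (switch_tails v i j (switch_tails v i j ps))"
  then show "switch_tails v i j (switch_tails v i j ps) ! k = ps ! k"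
    using ij v
    by (subst switch_tails_def) (auto simp: nth_list_update nth_switch_tails splice_at_splice_at)
qed simp

lemma mem_switch_tails_iff:
  "k < length ps \<Longrightarrow> v \<in> set (switch_tails v i j ps ! k) \<longleftrightarrow> v \<in> set (ps ! k)"
  using v by (simp add: nth_switch_tails mem_splice_at)

text \<open>Switching only redistributes vertices between two paths. This invariance fixes the
  choice of meeting vertex and keeps an intersecting tuple intersecting.\<close>

lemma mset_concat_switch_tails: "mset (concat (switch_tails v i j ps)) = mset (concat ps)"
proof -
  have expand: "mset (concat qs) = mset (qs ! i) + mset (qs ! j) +
      (\<Sum>k\<in>{..<length ps} - {i} - {j}. mset (qs ! k))"
    if "length qs = length ps" for qs :: "'a list list"
  proof -
    have "mset (concat qs) = (\<Sum>k<length ps. mset (qs ! k))"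
      using that by (simp add: mset_concat sum_list_sum_nth lessThan_atLeast0)
    also have "\<dots> = mset (qs ! i) + (\<Sum>k\<in>{..<length ps} - {i}. mset (qs ! k))"
      using ij by (intro sum.remove) auto
    also have "(\<Sum>k\<in>{..<length ps} - {i}. mset (qs ! k)) =
        mset (qs ! j) + (\<Sum>k\<in>{..<length ps} - {i} - {j}. mset (qs ! k))"
      using ij by (intro sum.remove) auto
    finally show ?thesis by (simp add: add.assoc)
  qed
  have "(\<Sum>k\<in>{..<length ps} - {i} - {j}. mset (switch_tails v i j ps ! k)) =
      (\<Sum>k\<in>{..<length ps} - {i} - {j}. mset (ps ! k))"
    by (rule sum.cong) (auto simp: nth_switch_tails)
  then show ?thesis
    using expand[of ps] expand[of "switch_tails v i j ps"] ij mset_splice_at[OF v]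
    by (simp add: nth_switch_tails)
qed

text \<open>Starting points stay in place and the arcs of the two paths are merely redistributed.
  The endpoints of paths \<open>i\<close> and \<open>j\<close> are exchanged, a transposition of
  columns in the \<open>\<phi>\<close> determinant.\<close>

lemma labelled_weight_switch_tails:
  assumes N: "length ps = N"
  shows "labelled_weight N \<psi> \<phi> w (switch_tails v i j ps) = - labelled_weight N \<psi> \<phi> w ps"
proof -
  let ?qs = "switch_tails v i j ps" and ?t = "Transposition.transpose i j"
  have t: "?t permutes {..<N}"
    using ij N by (intro permutes_swap_id) auto
  have "hd (?qs ! k) = hd (ps ! k)" if "k < N" for k
    using that v N by (auto simp: nth_switch_tails hd_splice_at)
  then have "mat N N (\<lambda>(a, k). \<psi> a (hd (?qs ! k))) = mat N N (\<lambda>(a, k). \<psi> a (hd (ps ! k)))"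
    by (auto intro!: cong_mat)
  moreover have "last (?qs ! k) = last (ps ! ?t k)" if "k < N" for k
    using that ij v N by (auto simp: nth_switch_tails last_splice_at Transposition.transpose_def)
  then have "mat N N (\<lambda>(a, k). \<phi> a (last (?qs ! k))) = mat N N (\<lambda>(a, k). \<phi> a (last (ps ! ?t k)))"
    by (auto intro!: cong_mat)
  moreover have "det (mat N N (\<lambda>(a, k). \<phi> a (last (ps ! ?t k)))) =
      - det (mat N N (\<lambda>(a, k). \<phi> a (last (ps ! k))))"
    using det_mat_permute_columns[OF t, of "\<lambda>a k. \<phi> a (last (ps ! k))"] ij
    by (simp add: sign_swap_id)
  moreover have "(\<Prod>k<N. path_weight w (?qs ! k)) = (\<Prod>k<N. path_weight w (ps ! k))"
  proof -
    have expand: "(\<Prod>k<N. path_weight w (qs ! k)) = path_weight w (qs ! i) * path_weight w (qs ! j) *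
        (\<Prod>k\<in>{..<N} - {i} - {j}. path_weight w (qs ! k))" for qs
      using ij N by (simp add: prod.remove[of "{..<N}" i] prod.remove[of "{..<N} - {i}" j] mult.assoc)
    have "(\<Prod>k\<in>{..<N} - {i} - {j}. path_weight w (?qs ! k)) =
        (\<Prod>k\<in>{..<N} - {i} - {j}. path_weight w (ps ! k))"
      using N by (intro prod.cong) (auto simp: nth_switch_tails)
    then show ?thesis
      using expand[of ps] expand[of ?qs] ij path_weight_splice_at[OF v, of w]
      by (simp add: nth_switch_tails)
  qed
  ultimately show ?thesis
    by (simp add: labelled_weight_def)
qed

end

section \<open>The sign-reversing involution on intersecting tuples\<close>

lemma shared_vertex_indices:
  assumes "\<forall>p\<in>set ps. distinct p" "count (mset (concat ps)) v \<ge> 2"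
  shows "\<exists>i j. i < length ps \<and> j < length ps \<and> i \<noteq> j \<and> v \<in> set (ps ! i) \<and> v \<in> set (ps ! j)"
proof (rule ccontr)
  let ?c = "\<lambda>k. count (mset (ps ! k)) v"
  assume neg: "\<not> ?thesis"
  have c: "count (mset (concat ps)) v = (\<Sum>k<length ps. ?c k)"
    by (simp add: mset_concat sum_list_sum_nth lessThan_atLeast0 count_sum)
  then obtain i where i: "i < length ps" "v \<in> set (ps ! i)"
    using assms(2)
    by (metis (no_types, lifting) sum.neutral lessThan_iff count_mset_0_iff not_numeral_le_zero)
  \<comment> \<open>If \<open>i\<close> were the only index of a path through \<open>v\<close>, all
    occurrences of \<open>v\<close> would lie on that path, which visits \<open>v\<close> at most
    once.\<close>
  then have "(\<Sum>k\<in>{..<length ps} - {i}. ?c k) = 0"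
    using neg by (intro sum.neutral) (auto simp: count_mset_0_iff)
  then have "(\<Sum>k<length ps. ?c k) = ?c i"
    using i by (simp add: sum.remove[of "{..<length ps}" i])
  also have "?c i \<le> 1"
    using assms(1) i by (simp add: distinct_count_atmost_1)
  finally show False using c assms(2) by simp
qed

text \<open>
  The vertex is chosen from the multiset of all visited vertices, and the two indices from the set
  of paths through that vertex. Switching tails preserves both, hence the choice as well.
\<close>

definition meeting_vertex :: "'a list list \<Rightarrow> 'a" where
  "meeting_vertex ps = (SOME v. count (mset (concat ps)) v \<ge> 2)"

definition meeting_pair :: "'a list list \<Rightarrow> nat \<times> nat" where
  "meeting_pair ps = (SOME (i, j). i < length ps \<and> j < length ps \<and> i \<noteq> j \<and>
     meeting_vertex ps \<in> set (ps ! i) \<and> meeting_vertex ps \<in> set (ps ! j))"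

definition switch_involution :: "'a list list \<Rightarrow> 'a list list" where
  "switch_involution ps =
     switch_tails (meeting_vertex ps) (fst (meeting_pair ps)) (snd (meeting_pair ps)) ps"

lemma meeting_pair:
  assumes "\<forall>p\<in>set ps. distinct p" "\<not> distinct (concat ps)"
  shows "fst (meeting_pair ps) < length ps" "snd (meeting_pair ps) < length ps"
    "fst (meeting_pair ps) \<noteq> snd (meeting_pair ps)"
    "meeting_vertex ps \<in> set (ps ! fst (meeting_pair ps))"
    "meeting_vertex ps \<in> set (ps ! snd (meeting_pair ps))"
proof -
  have "\<exists>v. count (mset (concat ps)) v \<ge> 2"
  proof (rule ccontr)
    assume "\<not> ?thesis"
    \<comment> \<open>With all counts below \<open>2\<close>, every count is the indicator of
      membership, which characterises a distinct list.\<close>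
    then have "count (mset (concat ps)) v = (if v \<in> set (concat ps) then 1 else 0)" for v
      using count_greater_zero_iff[of "mset (concat ps)" v] by 
        (auto simp: not_le numeral_2_eq_2 less_Suc_eq count_eq_zero_iff simp del: mset_concat)
    then show False using assms(2) by (simp add: distinct_count_atmost_1)
  qed
  then have "count (mset (concat ps)) (meeting_vertex ps) \<ge> 2"
    unfolding meeting_vertex_def by (rule someI_ex)
  from shared_vertex_indices[OF assms(1) this]
  have "\<exists>x. case x of (i, j) \<Rightarrow> i < length ps \<and> j < length ps \<and> i \<noteq> j \<and>
     meeting_vertex ps \<in> set (ps ! i) \<and> meeting_vertex ps \<in> set (ps ! j)" by auto
  then have "case meeting_pair ps of (i, j) \<Rightarrow> i < length ps \<and> j < length ps \<and> i \<noteq> j \<and>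
     meeting_vertex ps \<in> set (ps ! i) \<and> meeting_vertex ps \<in> set (ps ! j)"
    unfolding meeting_pair_def by (rule someI_ex)
  then show "fst (meeting_pair ps) < length ps" "snd (meeting_pair ps) < length ps"
    "fst (meeting_pair ps) \<noteq> snd (meeting_pair ps)"
    "meeting_vertex ps \<in> set (ps ! fst (meeting_pair ps))"
    "meeting_vertex ps \<in> set (ps ! snd (meeting_pair ps))"
    by (auto simp: case_prod_beta)
qed

lemma switch_involution_switch_involution:
  assumes "\<forall>p\<in>set ps. distinct p" "\<not> distinct (concat ps)"
  shows "switch_involution (switch_involution ps) = ps"
proof -
  let ?qs = "switch_involution ps"
  note m = meeting_pair[OF assms]
  have v: "meeting_vertex ?qs = meeting_vertex ps"
    unfolding switch_involution_def meeting_vertex_def[of "switch_tails _ _ _ _"]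
      mset_concat_switch_tails[OF m] meeting_vertex_def[symmetric] ..
  \<comment> \<open>The two predicates are equal as functions, so \<open>SOME\<close> returns the
    very same ordered pair for both tuples.\<close>
  have "(\<lambda>(i, j). i < length ?qs \<and> j < length ?qs \<and> i \<noteq> j \<and>
      meeting_vertex ps \<in> set (?qs ! i) \<and> meeting_vertex ps \<in> set (?qs ! j)) =
    (\<lambda>(i, j). i < length ps \<and> j < length ps \<and> i \<noteq> j \<and>
      meeting_vertex ps \<in> set (ps ! i) \<and> meeting_vertex ps \<in> set (ps ! j))"
    unfolding switch_involution_def
    by (auto simp: fun_eq_iff mem_switch_tails_iff[OF m])
  then have "meeting_pair ?qs = meeting_pair ps"
    unfolding meeting_pair_def v by simp
  then show ?thesis
    using switch_tails_switch_tails[OF m] v by (simp add: switch_involution_def)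
qed

section \<open>Cancellation of intersecting paths\<close>

lemma sum_labelled_weight_intersecting:
  assumes dist: "\<And>p. p \<in> P \<Longrightarrow> distinct p"
    and closed: "\<And>v p q. p \<in> P \<Longrightarrow> q \<in> P \<Longrightarrow> v \<in> set p \<Longrightarrow> v \<in> set q \<Longrightarrow> splice_at v p q \<in> P"
  shows "(\<Sum>ps | set ps \<subseteq> P \<and> length ps = N \<and> \<not> distinct (concat ps).
    labelled_weight N \<psi> \<phi> w ps) = 0"
proof -
  let ?B = "{ps. set ps \<subseteq> P \<and> length ps = N \<and> \<not> distinct (concat ps)}"
  have B: "switch_involution ps \<in> ?B \<and> switch_involution (switch_involution ps) = ps \<and>
      labelled_weight N \<psi> \<phi> w (switch_involution ps) = - labelled_weight N \<psi> \<phi> w ps"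
    if ps: "ps \<in> ?B" for ps
  proof -
    have d: "\<forall>p\<in>set ps. distinct p" "\<not> distinct (concat ps)"
      using ps dist by auto
    note m = meeting_pair[OF d]
    \<comment> \<open>Only positions in the meeting pair change, and their new entries are splices,
      which \<open>closed\<close> keeps in \<open>P\<close>.\<close>
    have "set (switch_involution ps) \<subseteq> P"
    proof
      fix p assume "p \<in> set (switch_involution ps)"
      then obtain k where "k < length ps" "p = switch_involution ps ! k"
        by (auto simp: in_set_conv_nth switch_involution_def)
      moreover have "ps ! l \<in> P" if "l < length ps" for l
        using ps that by (auto dest: nth_mem)
      ultimately show "p \<in> P"
        using m closed by (auto simp: switch_involution_def nth_switch_tails[OF m])
    qed
    moreover have "\<not> distinct (concat (switch_involution ps))"
      using d(2) mset_concat_switch_tails[OF m] mset_eq_imp_distinct_iff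
      unfolding switch_involution_def by blast
    ultimately show ?thesis
      using ps switch_involution_switch_involution[OF d]
        labelled_weight_switch_tails[OF m, of N \<psi> \<phi> w]
      by (simp add: switch_involution_def)
  qed
  \<comment> \<open>Reindexing by the involution shows that the sum equals its own negative.\<close>
  have "(\<Sum>ps\<in>?B. labelled_weight N \<psi> \<phi> w ps) = (\<Sum>ps\<in>?B. - labelled_weight N \<psi> \<phi> w ps)"
    by (rule sum.reindex_bij_witness[of _ switch_involution switch_involution]) (use B in auto)
  then show ?thesis by (simp add: sum_negf)
qed

text \<open>A disjoint family of \<open>N\<close> paths has \<open>N!\<close> orderings, all of the
  same labelled weight. For nonempty paths, \<open>distinct (concat ps)\<close> also rules out a
  path listed twice.\<close>

lemma sum_labelled_weight_disjoint:
  assumes "finite P" and ne: "[] \<notin> P" and dist: "\<And>p. p \<in> P \<Longrightarrow> distinct p"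
  shows "(\<Sum>ps | set ps \<subseteq> P \<and> length ps = N \<and> distinct (concat ps). labelled_weight N \<psi> \<phi> w ps) =
    fact N * (\<Sum>F | F \<subseteq> P \<and> finite F \<and> card F = N \<and> pairwise (\<lambda>p q. disjnt (set p) (set q)) F.
      family_weight N \<psi> \<phi> w F)"
proof -
  let ?D = "{ps. set ps \<subseteq> P \<and> length ps = N \<and> distinct (concat ps)}"
  let ?F = "{F. F \<subseteq> P \<and> finite F \<and> card F = N \<and> pairwise (\<lambda>p q. disjnt (set p) (set q)) F}"
  have D: "ps \<in> ?D \<longleftrightarrow> set ps \<in> ?F \<and> distinct ps" for ps
  proof (cases "set ps \<subseteq> P")
    case True
    \<comment> \<open>\<open>distinct_concat_iff\<close> demands distinctness only after empty lists
      are removed; here there are none.\<close>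
    then have "removeAll [] ps = ps" "\<forall>p\<in>set ps. distinct p"
      using ne dist by (meson removeAll_id subsetD)+
    then have "distinct (concat ps) \<longleftrightarrow>
        distinct ps \<and> pairwise (\<lambda>p q. disjnt (set p) (set q)) (set ps)"
      by (auto simp: distinct_concat_iff pairwise_def disjnt_def)
    then show ?thesis
      using True distinct_card[of ps] by auto
  qed simp
  have "(\<Sum>ps\<in>?D. labelled_weight N \<psi> \<phi> w ps) =
      (\<Sum>F\<in>?F. \<Sum>ps | ps \<in> ?D \<and> set ps = F. labelled_weight N \<psi> \<phi> w ps)"
  proof (rule sum.group[symmetric])
    show "finite ?D"
      by (rule finite_subset[OF _ finite_lists_length_eq[OF \<open>finite P\<close>, of N]]) auto
    show "finite ?F"
      by (rule finite_subset[of _ "Pow P"]) (use \<open>finite P\<close> in auto)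
    show "set ` ?D \<subseteq> ?F"
      using D by blast
  qed
  also have "\<dots> = (\<Sum>F\<in>?F. fact N * family_weight N \<psi> \<phi> w F)"
  proof (rule sum.cong)
    fix F assume F: "F \<in> ?F"
    \<comment> \<open>The fibre over \<open>F\<close> consists of all orderings of \<open>F\<close>,
      hence the factor \<open>fact N\<close>.\<close>
    then have "{ps. ps \<in> ?D \<and> set ps = F} = permutations_of_set F"
      using D by (auto simp: permutations_of_set_def)
    moreover have "labelled_weight N \<psi> \<phi> w ps = family_weight N \<psi> \<phi> w F"
      if "ps \<in> permutations_of_set F" for ps
      using that F by (auto simp: permutations_of_set_def intro!: family_weight_eq[symmetric])
    ultimately have "(\<Sum>ps | ps \<in> ?D \<and> set ps = F. labelled_weight N \<psi> \<phi> w ps) =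
        (\<Sum>ps\<in>permutations_of_set F. family_weight N \<psi> \<phi> w F)"
      by simp
    then show "(\<Sum>ps | ps \<in> ?D \<and> set ps = F. labelled_weight N \<psi> \<phi> w ps) =
        fact N * family_weight N \<psi> \<phi> w F"
      using F by simp
  qed simp
  finally show ?thesis by (simp add: sum_distrib_left)
qed

section \<open>Walks in acyclic digraphs\<close>

lemma trancl_vwalk_arcs:
  assumes "set (vwalk_arcs (u # p)) \<subseteq> r" "x \<in> set p"
  shows "(u, x) \<in> r\<^sup>+"
  using assms
proof (induction p arbitrary: u)
  case (Cons y p)
  then have "(u, y) \<in> r\<^sup>+" by auto
  then show ?case
    using Cons by (auto intro: trancl_trans)
qed simp

text \<open>A vertex occurring again later in a walk would be reachable from itself by at least one
  arc.\<close>

lemma acyclic_vwalk_distinct: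
  assumes "acyclic (arcs_ends G)" "vwalk p G"
  shows "distinct p"
proof -
  \<comment> \<open>The induction uses the arc condition alone, since \<open>vwalk\<close> excludes
    the empty list reached at the end.\<close>
  have "set (vwalk_arcs p) \<subseteq> arcs_ends G \<Longrightarrow> distinct p"
  proof (induction p)
    case (Cons u p)
    have "set (vwalk_arcs p) \<subseteq> set (vwalk_arcs (u # p))" by (cases p) auto
    then show ?case
      using Cons trancl_vwalk_arcs[of u p "arcs_ends G" u] assms(1) by (auto simp: acyclic_def)
  qed simp
  then show ?thesis using assms(2) by (simp add: vwalk_def)
qed

lemma finite_acyclic_vwalks:
  assumes "finite (verts G)" "acyclic (arcs_ends G)"
  shows "finite {p. vwalk p G}"
proof (rule finite_subset)
  show "{p. vwalk p G} \<subseteq> {p. set p \<subseteq> verts G \<and> length p \<le> card (verts G)}"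
  proof clarify
    fix p assume p: "vwalk p G"
    then have "set p \<subseteq> verts G" by (simp add: vwalk_def)
    moreover have "length p = card (set p)"
      using acyclic_vwalk_distinct[OF assms(2) p] by (simp add: distinct_card)
    ultimately show "set p \<subseteq> verts G \<and> length p \<le> card (verts G)"
      using assms(1) by (simp add: card_mono)
  qed
  show "finite {p. set p \<subseteq> verts G \<and> length p \<le> card (verts G)}"
    by (rule finite_lists_length_le[OF assms(1)])
qed

text \<open>A Lindstroem-Gessel-Viennot formula with boundary functions: start and end points are
  summed over, and the \<open>\<phi>\<close> determinant supplies the signs of the endpoint
  pairings.\<close>

lemma partition_function_eq_det:
  assumes fin: "finite (pverts G)" and acyc: "acyclic (parcs G)"
    and X: "finite X" and Y: "finite Y"
  shows "partition_function G N X Y \<psi> \<phi> w =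
    det (mat N N (\<lambda>(i, j). \<Sum>x\<in>X. \<psi> i x * kernel_operator Y (path_kernel G w) (\<phi> j) x))"
proof -
  let ?P = "\<Union>x\<in>X. \<Union>y\<in>Y. dipaths G x y"
  have P: "?P = {p. vwalk p (with_proj G) \<and> hd p \<in> X \<and> last p \<in> Y}"
    by (auto simp: dipaths_def)
  have walks: "finite {p. vwalk p (with_proj G)}"
    by (rule finite_acyclic_vwalks) (use fin acyc in simp_all)
  then have finP: "finite ?P" unfolding P by (rule rev_finite_subset) auto
  have ne: "[] \<notin> ?P" unfolding P by (simp add: vwalk_def)
  have dist: "distinct p" if "p \<in> ?P" for p
    using acyclic_vwalk_distinct[of "with_proj G" p] acyc that unfolding P by simp
  \<comment> \<open>A splice starts where \<open>p\<close> does and ends where \<open>q\<close>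
    does. It stays in \<open>?P\<close> because \<open>?P\<close> allows every pair of endpoints in
    \<open>X\<close> and \<open>Y\<close>.\<close>
  have closed: "splice_at v p q \<in> ?P" if "p \<in> ?P" "q \<in> ?P" "v \<in> set p" "v \<in> set q" for v p q
    using that vwalk_splice_at[of p "with_proj G" q v] unfolding P
    by (simp add: hd_splice_at last_splice_at)
  let ?M = "\<lambda>i j. \<Sum>p\<in>?P. \<psi> i (hd p) * path_weight w p * \<phi> j (last p)"
  let ?L = "{ps. set ps \<subseteq> ?P \<and> length ps = N}"
  \<comment> \<open>Sorting the paths by their two endpoints turns the sum over paths into the path
    kernel.\<close>
  have "?M i j = (\<Sum>x\<in>X. \<psi> i x * kernel_operator Y (path_kernel G w) (\<phi> j) x)" for i j
  proof -
    have fin_xy: "finite (dipaths G x y)" for x y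
      using walks by (rule rev_finite_subset) (auto simp: dipaths_def)
    have "?M i j = (\<Sum>x\<in>X. \<Sum>p\<in>(\<Union>y\<in>Y. dipaths G x y). \<psi> i (hd p) * path_weight w p * \<phi> j (last p))"
      using X Y fin_xy by (intro sum.UNION_disjoint) (auto simp: dipaths_def)
    also have "\<dots> = (\<Sum>x\<in>X. \<Sum>y\<in>Y. \<Sum>p\<in>dipaths G x y. \<psi> i (hd p) * path_weight w p * \<phi> j (last p))"
      using Y fin_xy by (intro sum.cong refl sum.UNION_disjoint) (auto simp: dipaths_def)
    also have "\<dots> = (\<Sum>x\<in>X. \<Sum>y\<in>Y. \<Sum>p\<in>dipaths G x y. \<psi> i x * path_weight w p * \<phi> j y)"
      by (intro sum.cong refl) (auto simp: dipaths_def)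
    finally show ?thesis
      by (simp add: kernel_operator_def path_kernel_def sum_distrib_left sum_distrib_right mult_ac)
  qed
  then have "fact N * det (mat N N
        (\<lambda>(i, j). \<Sum>x\<in>X. \<psi> i x * kernel_operator Y (path_kernel G w) (\<phi> j) x)) =
      (\<Sum>ps\<in>?L. labelled_weight N \<psi> \<phi> w ps)"
    using sum_labelled_weight[OF finP, of N \<psi> \<phi> w] by simp
  also have "\<dots> =
      (\<Sum>ps | set ps \<subseteq> ?P \<and> length ps = N \<and> distinct (concat ps). labelled_weight N \<psi> \<phi> w ps) +
      (\<Sum>ps | set ps \<subseteq> ?P \<and> length ps = N \<and> \<not> distinct (concat ps). labelled_weight N \<psi> \<phi> w ps)"
    by (subst sum.union_disjoint[symmetric])
      (auto intro!: sum.cong intro: finite_subset[OF _ finite_lists_length_eq[OF finP, of N]])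
  also have "\<dots> = fact N * partition_function G N X Y \<psi> \<phi> w"
    unfolding partition_function_def nonintersecting_def
    using sum_labelled_weight_intersecting[of ?P N \<psi> \<phi> w, OF dist closed]
      sum_labelled_weight_disjoint[of ?P N \<psi> \<phi> w, OF finP ne dist] by simp
  finally show ?thesis by simp
qed

section \<open>The Fredholm determinant\<close>

text \<open>Along an enumeration of \<open>X\<close> the matrix is the identity plus
  \<open>?U * ?V\<close>, with inner dimension \<open>N\<close>; commuting the factors leaves an
  \<open>N\<close> by \<open>N\<close> determinant.\<close>

lemma det_on_finite_rank:
  fixes u v :: "nat \<Rightarrow> 'a \<Rightarrow> real"
  assumes "finite X"
  shows "det_on X (\<lambda>x y. (if x = y then 1 else 0) + (\<Sum>i<N. u i x * v i y)) =
    det (mat N N (\<lambda>(i, j). (if i = j then 1 else 0) + (\<Sum>x\<in>X. v i x * u j x)))"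
proof -
  obtain xs where xs: "distinct xs" "set xs = X"
    using finite_distinct_list[OF assms] by auto
  let ?n = "length xs"
  let ?U = "mat ?n N (\<lambda>(k, i). u i (xs ! k))" and ?V = "mat N ?n (\<lambda>(i, k). v i (xs ! k))"
  have "det_on X (\<lambda>x y. (if x = y then 1 else 0) + (\<Sum>i<N. u i x * v i y)) = det (1\<^sub>m ?n + ?U * ?V)"
    unfolding xs(2)[symmetric] det_on_eq_det[OF xs(1)]
    by (rule arg_cong[of _ _ det], rule eq_matI)
      (auto simp: scalar_prod_def nth_eq_iff_index_eq[OF xs(1)] lessThan_atLeast0)
  also have "\<dots> = det (1\<^sub>m N + ?V * ?U)"
    by (rule det_one_plus_mult_commute) auto
  also have "1\<^sub>m N + ?V * ?U =
      mat N N (\<lambda>(i, j). (if i = j then 1 else 0) + (\<Sum>x\<in>X. v i x * u j x))"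
  proof -
    have "(\<Sum>x\<in>X. g x) = (\<Sum>k = 0..<?n. g (xs ! k))" for g :: "'a \<Rightarrow> real"
      using sum.reindex_bij_betw[OF bij_betw_nth[OF xs(1) refl refl], of g] xs(2)
      by (simp add: lessThan_atLeast0)
    then show ?thesis
      by (intro eq_matI) (auto simp: scalar_prod_def)
  qed
  finally show ?thesis .
qed

theorem theorem2p2:
  fixes G :: "'a pair_pre_digraph"
    and N :: nat
    and X Y :: "'a set"
    and w w' :: "'a \<times> 'a \<Rightarrow> real"
    and \<psi> \<phi> :: "nat \<Rightarrow> 'a \<Rightarrow> real"
  assumes fin: "pair_fin_digraph G"
    and acyc: "acyclic (parcs G)"
    and planar: "planar_digraph (with_proj G)"
    and N: "N \<ge> 1"
    and X: "X \<subseteq> pverts G" "card X \<ge> N"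
    and Y: "Y \<subseteq> pverts G" "card Y \<ge> N"
    and biorthogonal: "\<And>i j. i < N \<Longrightarrow> j < N \<Longrightarrow>
      (\<Sum>x\<in>X. \<psi> i x * kernel_operator Y (path_kernel G w) (\<phi> j) x) = (if i = j then 1 else 0)"
  shows "partition_function G N X Y \<psi> \<phi> w \<noteq> 0 \<and>
    partition_function G N X Y \<psi> \<phi> w' / partition_function G N X Y \<psi> \<phi> w =
      operator_det X (\<lambda>f x. f x
        - kernel_operator X (boundary_kernel G N Y \<psi> \<phi> w) f x
        + kernel_operator Y (path_kernel G w') (inverse_kernel_operator N X \<psi> \<phi> f) x)"
proof -
  let ?W = "\<lambda>w j. kernel_operator Y (path_kernel G w) (\<phi> j)"
  have fV: "finite (pverts G)"
    using fin by (rule pair_fin_digraph.pair_finite_verts)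
  then have fX: "finite X" and fY: "finite Y"
    using X Y finite_subset by blast+
  note Z = partition_function_eq_det[OF fV acyc fX fY, of N \<psi> \<phi>]
  \<comment> \<open>Biorthogonality makes the denominator \<open>1\<close>, so it is nonzero and the
    quotient is just the numerator.\<close>
  have "mat N N (\<lambda>(i, j). \<Sum>x\<in>X. \<psi> i x * ?W w j x) = 1\<^sub>m N"
    using biorthogonal by (intro eq_matI) auto
  then have Z1: "partition_function G N X Y \<psi> \<phi> w = 1"
    by (simp add: Z)
  let ?T = "\<lambda>f x. f x - kernel_operator X (boundary_kernel G N Y \<psi> \<phi> w) f x
        + kernel_operator Y (path_kernel G w') (inverse_kernel_operator N X \<psi> \<phi> f) x"
  \<comment> \<open>Both correction terms have the factors \<open>\<psi> i y\<close> in common, so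
    together they form a single sum of \<open>N\<close> rank one kernels. For \<open>y\<close> in
    \<open>X\<close>, pairing with the basis function evaluates at \<open>y\<close>.\<close>
  have "?T (indicator {y}) x = (if x = y then 1 else 0) + (\<Sum>i<N. (?W w' i x - ?W w i x) * \<psi> i y)"
    if y: "y \<in> X" for x y
  proof -
    have single: "(\<Sum>z\<in>X. h z * indicator {y} z) = h y" for h :: "'a \<Rightarrow> real"
      using y fX by (simp add: indicator_def if_distrib cong: if_cong)
    have "kernel_operator Y (path_kernel G w') (inverse_kernel_operator N X \<psi> \<phi> (indicator {y})) x =
        (\<Sum>i<N. ?W w' i x * \<psi> i y)"
      unfolding kernel_operator_def inverse_kernel_operator_def inner_on_def single
      by (simp add: sum_distrib_left sum_distrib_right mult_ac) (rule sum.swap)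
    then show ?thesis
      using single[of "boundary_kernel G N Y \<psi> \<phi> w x"]
      by (simp add: kernel_operator_def[of X] boundary_kernel_def left_diff_distrib sum_subtractf
          indicator_def)
  qed
  then have "operator_det X ?T =
      det_on X (\<lambda>x y. (if x = y then 1 else 0) + (\<Sum>i<N. (?W w' i x - ?W w i x) * \<psi> i y))"
    unfolding operator_det_def det_on_def
    by (intro sum.cong prod.cong arg_cong2[of _ _ _ _ "(*)"] refl) (simp add: permutes_in_image)
  also have "\<dots> = det (mat N N (\<lambda>(i, j). (if i = j then 1 else 0) +
      (\<Sum>x\<in>X. \<psi> i x * (?W w' j x - ?W w j x))))"
    by (rule det_on_finite_rank[OF fX])
  \<comment> \<open>By biorthogonality the \<open>w\<close> part of the difference is exactly the
    identity matrix and cancels it.\<close>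
  also have "mat N N (\<lambda>(i, j). (if i = j then 1 else 0) + (\<Sum>x\<in>X. \<psi> i x * (?W w' j x - ?W w j x))) =
      mat N N (\<lambda>(i, j). \<Sum>x\<in>X. \<psi> i x * ?W w' j x)"
    using biorthogonal by (intro eq_matI) (auto simp: right_diff_distrib sum_subtractf)
  finally show ?thesis
    using Z1 by (simp add: Z)
qed

end
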